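(* Let $G=(V,E)$ be a finite simple graph with node weights $w\in\mathbb{R}^V_+$ and edge weights satisfying $w_{ij}\ge\max\{w_i,w_j\}$ for all edges $ij\in E$. Then $$\mathrm{rk}_H(G,w)\le |V(G)|-\alpha(G)+1.$$
   Context: Let $V=[n]$. $\alpha(G)$ is the maximum cardinality of a stable set of $G$ (set of pairwise non-adjacent nodes), and $\alpha(G,w)$ is the maximum of $w(S)=\sum_{i\in S}w_i$ over stable sets $S$ of $G$. For $I\subseteq V$ write $x^I=\prod_{i\in I}x_i$ and $(1-x)^I=\prod_{i\in I}(1-x_i)$. For an integer $t\ge 1$, $$H_t=\Big\{\sum_{T\subseteq V,\ |T|\le t}\ \sum_{I\subseteq T}c_{T,I}\,x^I(1-x)^{T\setminus I}:\ c_{T,I}\ge 0\Big\}\subseteq\mathbb{R}[x_1,\dots,x_n].$$ Set $p_{G,w}=\sum_{i\in V}w_ix_i-\sum_{ij\in E}w_{ij}x_ix_j$ and $p_{\mathrm{han}}^{(t)}(G,w)=\inf\{\lambda\in\mathbb{R}:\lambda-p_{G,w}\in H_t\}$. The Handelman rank $\mathrm{rk}_H(G,w)$ is the smallest integer $t\ge1$ for which $p_{\mathrm{han}}^{(t)}(G,w)=\alpha(G,w)$; equivalently, the smallest $t$ for which $\alpha(G,w)-p_{G,w}\in H_t$. *)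

theory Defs
  imports Complex_Main "HOL-Library.Poly_Mapping" "HOL-Library.Extended_Real"
begin

text \<open>A graph is given by its node set \<open>V\<close> and its set \<open>E\<close> of edges, an edge being a
  two-element set of nodes.\<close>

definition simple_graph :: "'a set \<Rightarrow> 'a set set \<Rightarrow> bool" where
  "simple_graph V E \<longleftrightarrow> finite V \<and> (\<forall>e\<in>E. e \<subseteq> V \<and> card e = 2)"

definition stable_set :: "'a set \<Rightarrow> 'a set set \<Rightarrow> 'a set \<Rightarrow> bool" where
  "stable_set V E S \<longleftrightarrow> S \<subseteq> V \<and> (\<forall>i\<in>S. \<forall>j\<in>S. {i, j} \<notin> E)"

definition stability_number :: "'a set \<Rightarrow> 'a set set \<Rightarrow> nat" where
  "stability_number V E = Max {card S | S. stable_set V E S}"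

definition weighted_stability_number :: "'a set \<Rightarrow> 'a set set \<Rightarrow> ('a \<Rightarrow> real) \<Rightarrow> real" where
  "weighted_stability_number V E w = Max {(\<Sum>i\<in>S. w i) | S. stable_set V E S}"

text \<open>Real polynomials with indeterminates indexed by \<open>'a\<close>: finitely supported maps from
  exponent vectors to coefficients, with the convolution product of \<^theory>\<open>HOL-Library.Poly_Mapping\<close>.\<close>

type_synonym 'a rpoly = "('a \<Rightarrow>\<^sub>0 nat) \<Rightarrow>\<^sub>0 real"

definition Const :: "real \<Rightarrow> 'a rpoly" where
  "Const c = Poly_Mapping.single 0 c"

definition Var :: "'a \<Rightarrow> 'a rpoly" where
  "Var i = Poly_Mapping.single (Poly_Mapping.single i 1) 1"

text \<open>The truncated Handelman cone \<open>H\<^sub>t\<close> of the cube \<open>[0,1]\<^sup>V\<close>.\<close>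

definition handelman_cone :: "'a set \<Rightarrow> nat \<Rightarrow> 'a rpoly set" where
  "handelman_cone V t =
    {(\<Sum>T\<in>{T. T \<subseteq> V \<and> card T \<le> t}. \<Sum>I\<in>Pow T.
        Const (c T I) * (\<Prod>i\<in>I. Var i) * (\<Prod>i\<in>T - I. 1 - Var i)) | c.
      \<forall>T I. T \<subseteq> V \<longrightarrow> card T \<le> t \<longrightarrow> I \<subseteq> T \<longrightarrow> 0 \<le> c T I}"

text \<open>Node weights \<open>w\<close> and edge weights \<open>u\<close>; for an edge \<open>e = {i, j}\<close> the inner product is
  the monomial \<open>x\<^sub>i x\<^sub>j\<close>.\<close>

definition graph_poly :: "'a set \<Rightarrow> 'a set set \<Rightarrow> ('a \<Rightarrow> real) \<Rightarrow> ('a set \<Rightarrow> real) \<Rightarrow> 'a rpoly" where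
  "graph_poly V E w u =
    (\<Sum>i\<in>V. Const (w i) * Var i) - (\<Sum>e\<in>E. Const (u e) * (\<Prod>i\<in>e. Var i))"

text \<open>The infimum is taken in the extended reals, so that it is \<open>\<infinity>\<close> if no \<open>l\<close> is feasible.\<close>

definition handelman_bound ::
  "'a set \<Rightarrow> 'a set set \<Rightarrow> ('a \<Rightarrow> real) \<Rightarrow> ('a set \<Rightarrow> real) \<Rightarrow> nat \<Rightarrow> ereal" where
  "handelman_bound V E w u t =
    Inf {ereal l | l. Const l - graph_poly V E w u \<in> handelman_cone V t}"

text \<open>The rank is \<open>\<infinity>\<close> if no level of the hierarchy is exact; a finite upper bound thus includes
  the existence of an exact level.\<close>

definition handelman_rank ::
  "'a set \<Rightarrow> 'a set set \<Rightarrow> ('a \<Rightarrow> real) \<Rightarrow> ('a set \<Rightarrow> real) \<Rightarrow> enat" where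
  "handelman_rank V E w u =
    Inf {enat t | t. 1 \<le> t \<and> handelman_bound V E w u t = ereal (weighted_stability_number V E w)}"

end

theory Submission
  imports Defs
begin

text \<open>Members of the cone are nonnegative on 0/1 points, so evaluating at the indicator of an
  optimal stable set shows that no level of the hierarchy drops below \<open>\<alpha>(G,w)\<close>. Conversely, let
  \<open>S\<close> be a stable set and \<open>a \<ge> \<alpha>(G,w)\<close>; by induction on \<open>|V - S|\<close>, the polynomial \<open>a - p\<^sub>G\<close> lies
  in \<open>H\<^sub>t\<close> for \<open>t = |V - S| + 1\<close>. For \<open>i \<in> V - S\<close> with neighbourhood \<open>N\<close>, the polynomial
  \<open>a - p\<^sub>G\<close> equals \<open>(1 - x\<^sub>i) (a - p)\<close> for \<open>G - i\<close>, plus \<open>x\<^sub>i (a - w\<^sub>i - p)\<close> for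
  \<open>G - i - N\<close>, plus nonnegative multiples of \<open>x\<^sub>i x\<^sub>j\<close> for \<open>j \<in> N\<close> (as \<open>u\<^sub>i\<^sub>j \<ge> w\<^sub>j\<close>) and of
  \<open>x\<^sub>i x\<^sub>j x\<^sub>k\<close> for edges \<open>jk\<close> of \<open>G - i\<close> meeting \<open>N\<close>. The cubic terms are harmless: an edge
  of \<open>G - i\<close> contains a node outside \<open>S\<close>, so they occur only if \<open>|V - S| \<ge> 2\<close>.\<close>

section \<open>Evaluation at 0/1 points\<close>

text \<open>At the indicator vector of \<open>S\<close> a monomial takes the value 1 if its support is contained
  in \<open>S\<close>, and 0 otherwise.\<close>

definition eval_indicator :: "'a set \<Rightarrow> 'a rpoly \<Rightarrow> real" where
  "eval_indicator S p = (\<Sum>m | m \<in> Poly_Mapping.keys p \<and> Poly_Mapping.keys m \<subseteq> S. Poly_Mapping.lookup p m)"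

text \<open>Coefficients outside the support vanish. This puts \<open>p\<close>, \<open>q\<close>
  and \<open>p + q\<close> over one index set.\<close>

lemma eval_indicator_superset:
  assumes "finite M" "Poly_Mapping.keys p \<subseteq> M"
  shows "eval_indicator S p = (\<Sum>m\<in>{m\<in>M. Poly_Mapping.keys m \<subseteq> S}. Poly_Mapping.lookup p m)"
  unfolding eval_indicator_def
  by (rule sum.mono_neutral_left) (use assms in \<open>auto simp: in_keys_iff\<close>)

lemma eval_indicator_zero [simp]: "eval_indicator S 0 = 0"
  by (simp add: eval_indicator_def)

lemma eval_indicator_add [simp]: "eval_indicator S (p + q) = eval_indicator S p + eval_indicator S q"
proof -
  let ?M = "Poly_Mapping.keys p \<union> Poly_Mapping.keys q"
  have M: "finite ?M" "Poly_Mapping.keys (p + q) \<subseteq> ?M"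
    using Poly_Mapping.keys_add[of p q] by simp_all
  show ?thesis
    using eval_indicator_superset[OF M] eval_indicator_superset[OF M(1), of p] eval_indicator_superset[OF M(1), of q]
    by (simp add: lookup_add sum.distrib)
qed

lemma eval_indicator_single:
  "eval_indicator S (Poly_Mapping.single m c) = (if Poly_Mapping.keys m \<subseteq> S then c else 0)"
proof -
  have "{k \<in> {m}. Poly_Mapping.keys k \<subseteq> S} = (if Poly_Mapping.keys m \<subseteq> S then {m} else {})"
    by auto
  then show ?thesis
    by (subst eval_indicator_superset[of "{m}"]) auto
qed

text \<open>Natural exponents cannot cancel, so a product of monomials survives at \<open>S\<close>
  exactly when both factors do.\<close>

lemma keys_add_nat: "Poly_Mapping.keys (m + n) = Poly_Mapping.keys m \<union> Poly_Mapping.keys (n :: 'a \<Rightarrow>\<^sub>0 nat)"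
  by (auto simp: in_keys_iff lookup_add)

text \<open>Peels off one term at a time, reducing identities additive in \<open>p\<close> to single
  monomials.\<close>

lemma poly_mapping_single_induct:
  fixes p :: "'a \<Rightarrow>\<^sub>0 'b :: ab_group_add"
  assumes "P 0" "\<And>m c q. P q \<Longrightarrow> P (Poly_Mapping.single m c + q)"
  shows "P p"
proof (induction "Poly_Mapping.keys p" arbitrary: p rule: infinite_finite_induct)
  case infinite
  then show ?case by simp
next
  case empty
  then show ?case using assms(1) by (metis keys_eq_empty)
next
  case (insert m F)
  define q where "q = p - Poly_Mapping.single m (Poly_Mapping.lookup p m)"
  have "Poly_Mapping.keys q = Poly_Mapping.keys p - {m}"
    by (auto simp: q_def in_keys_iff lookup_minus lookup_single when_def split: if_splits)
  then have "P q" using insert by (metis Diff_insert_absorb)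
  then have "P (Poly_Mapping.single m (Poly_Mapping.lookup p m) + q)" by (rule assms(2))
  then show ?case by (simp add: q_def)
qed

lemma eval_indicator_mult [simp]: "eval_indicator S (p * q) = eval_indicator S p * eval_indicator S q"
proof (induction p rule: poly_mapping_single_induct)
  case 1
  then show ?case by simp
next
  case (2 m c p)
  have "eval_indicator S (Poly_Mapping.single m c * q) = eval_indicator S (Poly_Mapping.single m c) * eval_indicator S q"
    by (induction q rule: poly_mapping_single_induct)
      (auto simp: distrib_left mult_single eval_indicator_single keys_add_nat)
  with 2 show ?case by (simp add: distrib_right)
qed

lemma eval_indicator_Const [simp]: "eval_indicator S (Const c) = c"
  by (simp add: Const_def eval_indicator_single)

lemma eval_indicator_Var [simp]: "eval_indicator S (Var i) = (if i \<in> S then 1 else 0)"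
  by (simp add: Var_def eval_indicator_single)

lemma eval_indicator_one [simp]: "eval_indicator S 1 = 1"
  using eval_indicator_Const[of S 1] by (simp add: Const_def)

lemma eval_indicator_diff [simp]: "eval_indicator S (p - q) = eval_indicator S p - eval_indicator S q"
  using eval_indicator_add[of S "p - q" q] by simp

lemma eval_indicator_sum [simp]: "eval_indicator S (\<Sum>i\<in>A. f i) = (\<Sum>i\<in>A. eval_indicator S (f i))"
  by (induction A rule: infinite_finite_induct) auto

lemma eval_indicator_prod [simp]: "eval_indicator S (\<Prod>i\<in>A. f i) = (\<Prod>i\<in>A. eval_indicator S (f i))"
  by (induction A rule: infinite_finite_induct) auto

text \<open>At a 0/1 point both products in a generator are 0 or 1.\<close>

lemma eval_indicator_cone_nonneg:
  assumes "p \<in> handelman_cone V t"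
  shows "0 \<le> eval_indicator S p"
  using assms unfolding handelman_cone_def
  by (auto intro!: sum_nonneg mult_nonneg_nonneg prod_nonneg)

lemma finite_edges: "simple_graph V E \<Longrightarrow> finite E"
  by (rule finite_subset[of _ "Pow V"]) (auto simp: simple_graph_def)

text \<open>Each edge has an endpoint outside \<open>S\<close>, which kills its monomial.\<close>

lemma eval_indicator_graph_poly:
  assumes G: "simple_graph V E" and S: "stable_set V E S"
  shows "eval_indicator S (graph_poly V E w u) = (\<Sum>i\<in>S. w i)"
proof -
  have fin: "finite V" "S \<subseteq> V" using G S by (auto simp: simple_graph_def stable_set_def)
  have "(\<Prod>i\<in>e. if i \<in> S then 1 else 0 :: real) = 0" if "e \<in> E" for e
  proof -
    obtain i j where e: "e = {i, j}"
      using G \<open>e \<in> E\<close> unfolding simple_graph_def by (metis card_2_iff)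
    then have "i \<notin> S \<or> j \<notin> S" using S \<open>e \<in> E\<close> by (auto simp: stable_set_def)
    then show ?thesis using e by (intro prod_zero) auto
  qed
  moreover have "(\<Sum>i\<in>V. w i * (if i \<in> S then 1 else 0)) = (\<Sum>i\<in>S. w i)"
    using fin by (intro sum.mono_neutral_cong_right) auto
  ultimately show ?thesis by (simp add: graph_poly_def)
qed

section \<open>Closure properties of the Handelman cone\<close>

lemma Const_0 [simp]: "Const 0 = 0" by (simp add: Const_def)
lemma Const_add: "Const (a + b) = Const a + Const b" by (simp add: Const_def single_add)
lemma Const_diff: "Const (a - b) = Const a - Const b" by (simp add: Const_def single_diff)

lemma cone_zero: "0 \<in> handelman_cone V t"
  unfolding handelman_cone_def by (intro CollectI exI[of _ "\<lambda>_ _. 0"]) auto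

lemma cone_add:
  assumes "p \<in> handelman_cone V t" "q \<in> handelman_cone V t"
  shows "p + q \<in> handelman_cone V t"
proof -
  from assms obtain c d where
    "p = (\<Sum>T\<in>{T. T \<subseteq> V \<and> card T \<le> t}. \<Sum>I\<in>Pow T.
        Const (c T I) * (\<Prod>i\<in>I. Var i) * (\<Prod>i\<in>T - I. 1 - Var i))"
    "q = (\<Sum>T\<in>{T. T \<subseteq> V \<and> card T \<le> t}. \<Sum>I\<in>Pow T.
        Const (d T I) * (\<Prod>i\<in>I. Var i) * (\<Prod>i\<in>T - I. 1 - Var i))"
    "\<forall>T I. T \<subseteq> V \<longrightarrow> card T \<le> t \<longrightarrow> I \<subseteq> T \<longrightarrow> 0 \<le> c T I"
    "\<forall>T I. T \<subseteq> V \<longrightarrow> card T \<le> t \<longrightarrow> I \<subseteq> T \<longrightarrow> 0 \<le> d T I"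
    unfolding handelman_cone_def by auto
  then show ?thesis
    unfolding handelman_cone_def
    by (intro CollectI exI[of _ "\<lambda>T I. c T I + d T I"])
      (simp add: Const_add distrib_right sum.distrib)
qed

lemma cone_sum:
  assumes "\<And>i. i \<in> A \<Longrightarrow> f i \<in> handelman_cone V t"
  shows "(\<Sum>i\<in>A. f i) \<in> handelman_cone V t"
  using assms by (induction A rule: infinite_finite_induct) (auto intro: cone_zero cone_add)

lemma cone_generator:
  assumes V: "finite V" and T: "T \<subseteq> V" "card T \<le> t" "I \<subseteq> T" and "0 \<le> c"
  shows "Const c * (\<Prod>i\<in>I. Var i) * (\<Prod>i\<in>T - I. 1 - Var i) \<in> handelman_cone V t" (is "?g \<in> _")
proof -
  \<comment> \<open>Coefficients concentrated at the single pair \<open>(T, I)\<close> collapse the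
    double sum to one generator.\<close>
  define d where "d = (\<lambda>T' I'. if T' = T \<and> I' = I then c else 0)"
  have finT: "finite T" using V T finite_subset by blast
  have "(\<Sum>T'\<in>{T. T \<subseteq> V \<and> card T \<le> t}. \<Sum>I'\<in>Pow T'.
        Const (d T' I') * (\<Prod>i\<in>I'. Var i) * (\<Prod>i\<in>T' - I'. 1 - Var i))
     = (\<Sum>T'\<in>{T. T \<subseteq> V \<and> card T \<le> t}. if T' = T then ?g else 0)"
  proof (rule sum.cong)
    fix T' assume "T' \<in> {T. T \<subseteq> V \<and> card T \<le> t}"
    have "(\<Sum>I'\<in>Pow T. Const (d T I') * (\<Prod>i\<in>I'. Var i) * (\<Prod>i\<in>T - I'. 1 - Var i))
        = (\<Sum>I'\<in>Pow T. if I' = I then ?g else 0)"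
      by (rule sum.cong) (auto simp: d_def)
    also have "\<dots> = ?g" using finT T by simp
    finally show "(\<Sum>I'\<in>Pow T'. Const (d T' I') * (\<Prod>i\<in>I'. Var i) * (\<Prod>i\<in>T' - I'. 1 - Var i))
        = (if T' = T then ?g else 0)"
      by (auto simp: d_def)
  qed simp
  also have "\<dots> = ?g" using V T by simp
  finally have "?g = (\<Sum>T'\<in>{T. T \<subseteq> V \<and> card T \<le> t}. \<Sum>I'\<in>Pow T'.
        Const (d T' I') * (\<Prod>i\<in>I'. Var i) * (\<Prod>i\<in>T' - I'. 1 - Var i))" ..
  moreover have "0 \<le> d T' I'" for T' I' using \<open>0 \<le> c\<close> by (simp add: d_def)
  ultimately show ?thesis unfolding handelman_cone_def by blast
qed

lemma cone_monomial:
  assumes "finite V" "T \<subseteq> V" "card T \<le> t" "0 \<le> c"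
  shows "Const c * (\<Prod>i\<in>T. Var i) \<in> handelman_cone V t"
  using cone_generator[of V T t T c] assms by simp

text \<open>The cone is the conic hull of its generators, so properties preserved by sums need
  checking only on these.\<close>

lemma cone_induct [consumes 2, case_names zero add generator]:
  assumes p: "p \<in> handelman_cone V t" and "finite V"
    and zero: "P 0" and add: "\<And>p q. P p \<Longrightarrow> P q \<Longrightarrow> P (p + q)"
    and generator: "\<And>c T I. T \<subseteq> V \<Longrightarrow> card T \<le> t \<Longrightarrow> I \<subseteq> T \<Longrightarrow> 0 \<le> c
      \<Longrightarrow> P (Const c * (\<Prod>i\<in>I. Var i) * (\<Prod>i\<in>T - I. 1 - Var i))"
  shows "P p"
proof -
  have sum: "P (\<Sum>i\<in>A. f i)" if "\<And>i. i \<in> A \<Longrightarrow> P (f i)" for A :: "'a set set" and f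
    using that by (induction A rule: infinite_finite_induct) (auto intro: zero add)
  show ?thesis
    using p unfolding handelman_cone_def by (auto intro!: sum generator)
qed

lemma cone_mono:
  assumes "p \<in> handelman_cone W s" "W \<subseteq> V" "finite V" "s \<le> t"
  shows "p \<in> handelman_cone V t"
proof -
  have "finite W" using assms finite_subset[of W V] by simp
  with assms(1) show ?thesis
  proof (induction rule: cone_induct)
    case (generator c T I)
    then show ?case using assms by (intro cone_generator) auto
  qed (simp_all add: cone_zero cone_add)
qed

text \<open>The pair \<open>(T, I)\<close> becomes \<open>(insert i T, insert i I)\<close>. As
  \<open>i \<notin> W\<close>, no square of \<open>Var i\<close> arises and \<open>T\<close> grows
  by one node.\<close>

lemma cone_mult_Var:
  assumes "p \<in> handelman_cone W t" "insert i W \<subseteq> V" "finite V" "i \<notin> W"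
  shows "Var i * p \<in> handelman_cone V (Suc t)"
proof -
  have "finite W" using assms finite_subset[of W V] by simp
  with assms(1) show ?thesis
  proof (induction rule: cone_induct)
    case zero
    then show ?case by (simp add: cone_zero)
  next
    case (add p q)
    then show ?case by (simp add: distrib_left cone_add)
  next
    case (generator c T I)
    have fin: "finite T" "finite I"
      using generator(1,3) \<open>finite W\<close> finite_subset[of T W] finite_subset[of I T] by simp_all
    have "i \<notin> T" "i \<notin> I" using generator assms by auto
    have "Const c * (\<Prod>i\<in>insert i I. Var i) * (\<Prod>i\<in>insert i T - insert i I. 1 - Var i)
        \<in> handelman_cone V (Suc t)"
      using generator assms fin \<open>i \<notin> T\<close> by (intro cone_generator) auto
    moreover have "insert i T - insert i I = T - I" using \<open>i \<notin> T\<close> by auto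
    ultimately show ?case using fin \<open>i \<notin> I\<close> by (simp add: algebra_simps)
  qed
qed

text \<open>Here \<open>i\<close> joins \<open>T\<close> but not \<open>I\<close>, so the new factor
  enters the product over \<open>T - I\<close>.\<close>

lemma cone_mult_one_minus_Var:
  assumes "p \<in> handelman_cone W t" "insert i W \<subseteq> V" "finite V" "i \<notin> W"
  shows "(1 - Var i) * p \<in> handelman_cone V (Suc t)"
proof -
  have "finite W" using assms finite_subset[of W V] by simp
  with assms(1) show ?thesis
  proof (induction rule: cone_induct)
    case zero
    then show ?case by (simp add: cone_zero)
  next
    case (add p q)
    then show ?case by (simp only: distrib_left cone_add)
  next
    case (generator c T I)
    have "finite T" using generator(1) \<open>finite W\<close> by (rule finite_subset)
    moreover have "i \<notin> T" "i \<notin> I" using generator assms by auto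
    ultimately have fin: "finite T" "finite (T - I)" and "i \<notin> T" "i \<notin> I" "i \<notin> T - I" by auto
    have "Const c * (\<Prod>i\<in>I. Var i) * (\<Prod>i\<in>insert i T - I. 1 - Var i)
        \<in> handelman_cone V (Suc t)"
      using generator assms fin \<open>i \<notin> T\<close> by (intro cone_generator) auto
    moreover have "insert i T - I = insert i (T - I)" using \<open>i \<notin> I\<close> by auto
    ultimately show ?case using fin \<open>i \<notin> T - I\<close> by (simp add: mult_ac)
  qed
qed

section \<open>Construction of the certificate\<close>

text \<open>Base case of the induction: without edges, the polynomial is the constant a - w(V) plus
  the terms w_i (1 - x_i).\<close>

lemma certificate_stable:
  assumes V: "finite V" and w: "\<And>i. i \<in> V \<Longrightarrow> 0 \<le> w i" and a: "(\<Sum>i\<in>V. w i) \<le> a"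
  shows "Const a - graph_poly V {} w u \<in> handelman_cone V 1"
proof -
  have C: "Const (\<Sum>i\<in>V. w i) = (\<Sum>i\<in>V. Const (w i))"
    using V by (induction V rule: finite_induct) (auto simp: Const_add)
  \<comment> \<open>Empty products are kept so that each summand has the literal shape of
    \<open>cone_generator\<close>, with \<open>I\<close> empty and \<open>T\<close> empty or
    \<open>{i}\<close>.\<close>
  have eq: "Const a - graph_poly V {} w u
      = Const (a - (\<Sum>i\<in>V. w i)) * (\<Prod>i\<in>{}. Var i) * (\<Prod>i\<in>{}-{}. 1 - Var i)
        + (\<Sum>i\<in>V. Const (w i) * (\<Prod>i\<in>{}. Var i) * (\<Prod>i\<in>{i} - {}. 1 - Var i))"
    by (simp add: graph_poly_def Const_diff C algebra_simps sum_subtractf)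
  show ?thesis
    unfolding eq by (intro cone_add cone_sum cone_generator) (use assms in auto)
qed

text \<open>Passing from G to G - i drops w_i x_i and the edges at i; passing on to G - i - N drops
  w_j x_j for j in N and the edges meeting N. The first difference and x_i times the second combine
  into the last two sums.\<close>

lemma graph_poly_split:
  assumes "simple_graph V E" "i \<in> V"
  defines "N \<equiv> {j. {i, j} \<in> E}"
  defines "V' \<equiv> V - {i} - N" and "E' \<equiv> {e \<in> E. i \<notin> e \<and> e \<inter> N = {}}"
  shows "Const a - graph_poly V E w u =
    (1 - Var i) * (Const a - graph_poly (V - {i}) {e \<in> E. i \<notin> e} w u)
    + Var i * (Const (a - w i) - graph_poly V' E' w u)
    + (\<Sum>j\<in>N. Const (u {i, j} - w j) * (\<Prod>k\<in>{i, j}. Var k))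
    + (\<Sum>e\<in>{e \<in> E. i \<notin> e} - E'. Const (u e) * (\<Prod>k\<in>insert i e. Var k))"
proof -
  have fin: "finite V" "finite E" and edge: "\<And>e. e \<in> E \<Longrightarrow> e \<subseteq> V \<and> card e = 2"
    using assms finite_edges by (auto simp: simple_graph_def)
  have "j \<in> V - {i}" if "j \<in> N" for j
    using that edge[of "{i, j}"] by (auto simp: N_def card_2_iff')
  then have N: "N \<subseteq> V - {i}" "finite N"
    using fin by (auto intro: finite_subset[of _ V])
  define E1 where "E1 = {e \<in> E. i \<notin> e}"
  have E1: "finite E1" "E' \<subseteq> E1" "E1 \<subseteq> E" using fin by (auto simp: E1_def E'_def)
  have E: "E = E1 \<union> (\<lambda>j. {i, j}) ` N"
  proof -
    have "\<exists>j. e = {i, j}" if "e \<in> E" "i \<in> e" for e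
      using edge[OF that(1)] that(2) by (auto simp: card_2_iff)
    then show ?thesis by (auto simp: E1_def N_def)
  qed
  have inj: "inj_on (\<lambda>j. {i, j}) N" by (auto simp: inj_on_def doubleton_eq_iff)
  \<comment> \<open>\<open>N\<close> excludes \<open>i\<close>, so the product over the set
    \<open>{i, j}\<close> really has two factors.\<close>
  have x: "(\<Prod>k\<in>{i, j}. Var k) = Var i * Var j" if "j \<in> N" for j
  proof -
    have "i \<noteq> j" using that N by blast
    then show ?thesis by simp
  qed
  have xe: "(\<Prod>k\<in>insert i e. Var k) = Var i * (\<Prod>k\<in>e. Var k)" if "e \<in> E1 - E'" for e
  proof -
    have "finite e" using that E1 edge fin by (meson DiffD1 finite_subset subsetD)
    then show ?thesis using that by (simp add: E1_def)
  qed
  have "(\<Sum>e\<in>E. Const (u e) * (\<Prod>k\<in>e. Var k)) = (\<Sum>e\<in>E1. Const (u e) * (\<Prod>k\<in>e. Var k))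
      + (\<Sum>e\<in>(\<lambda>j. {i, j}) ` N. Const (u e) * (\<Prod>k\<in>e. Var k))"
    unfolding E by (rule sum.union_disjoint) (use E1 N in \<open>auto simp: E1_def\<close>)
  also have "(\<Sum>e\<in>(\<lambda>j. {i, j}) ` N. Const (u e) * (\<Prod>k\<in>e. Var k))
      = (\<Sum>j\<in>N. Const (u {i, j}) * (Var i * Var j))"
    unfolding sum.reindex[OF inj] by (rule sum.cong) (simp_all only: o_def x)
  finally have g0: "graph_poly V E w u = graph_poly (V - {i}) E1 w u + Const (w i) * Var i
      - (\<Sum>j\<in>N. Const (u {i, j}) * (Var i * Var j))"
    using fin assms(2) by (simp add: graph_poly_def sum.remove[of V i])
  have "(\<Sum>j\<in>V - {i}. Const (w j) * Var j)
      = (\<Sum>j\<in>V'. Const (w j) * Var j) + (\<Sum>j\<in>N. Const (w j) * Var j)"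
    unfolding V'_def using fin N by (intro sum.subset_diff) auto
  moreover have "(\<Sum>e\<in>E1. Const (u e) * (\<Prod>k\<in>e. Var k))
      = (\<Sum>e\<in>E1 - E'. Const (u e) * (\<Prod>k\<in>e. Var k)) + (\<Sum>e\<in>E'. Const (u e) * (\<Prod>k\<in>e. Var k))"
    using E1 by (intro sum.subset_diff) auto
  ultimately have g1: "graph_poly (V - {i}) E1 w u = graph_poly V' E' w u
      + (\<Sum>j\<in>N. Const (w j) * Var j) - (\<Sum>e\<in>E1 - E'. Const (u e) * (\<Prod>k\<in>e. Var k))"
    by (simp add: graph_poly_def)
  have s1: "(\<Sum>j\<in>N. Const (u {i, j} - w j) * (\<Prod>k\<in>{i, j}. Var k))
      = (\<Sum>j\<in>N. Const (u {i, j}) * (Var i * Var j)) - Var i * (\<Sum>j\<in>N. Const (w j) * Var j)"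
    unfolding sum_distrib_left sum_subtractf[symmetric]
    by (rule sum.cong) (simp_all only: x Const_diff algebra_simps)
  have s2: "(\<Sum>e\<in>E1 - E'. Const (u e) * (\<Prod>k\<in>insert i e. Var k))
      = Var i * (\<Sum>e\<in>E1 - E'. Const (u e) * (\<Prod>k\<in>e. Var k))"
    unfolding sum_distrib_left
    by (rule sum.cong) (simp_all only: xe mult_ac)
  show ?thesis
    unfolding E1_def[symmetric] g0 s1 s2 g1 by (simp add: Const_diff algebra_simps)
qed

text \<open>Maximality of \<open>S\<close> and tightness of \<open>a\<close> need not pass to the
  smaller graphs, so the induction allows any stable \<open>S\<close> and any upper bound
  \<open>a\<close> on the stable weights.\<close>

lemma handelman_certificate:
  assumes "simple_graph V E"
    and "\<And>i. i \<in> V \<Longrightarrow> 0 \<le> w i"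
    and "\<And>i j. {i, j} \<in> E \<Longrightarrow> max (w i) (w j) \<le> u {i, j}"
    and "stable_set V E S"
    and "\<And>R. stable_set V E R \<Longrightarrow> (\<Sum>i\<in>R. w i) \<le> a"
  shows "Const a - graph_poly V E w u \<in> handelman_cone V (Suc (card (V - S)))"
  using assms
proof (induction "card (V - S)" arbitrary: V E S a rule: less_induct)
  case less
  note G = less.prems(1) and w = less.prems(2) and u = less.prems(3)
    and S = less.prems(4) and a = less.prems(5)
  have fin: "finite V" and edge: "\<And>e. e \<in> E \<Longrightarrow> e \<subseteq> V \<and> card e = 2"
    using G by (auto simp: simple_graph_def)
  have SV: "S \<subseteq> V" using S by (simp add: stable_set_def)
  have edge_not_sub: "\<not> e \<subseteq> S" if "e \<in> E" for e
  proof -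
    obtain j k where "e = {j, k}" using edge[OF \<open>e \<in> E\<close>] by (auto simp: card_2_iff)
    then show ?thesis using S that by (auto simp: stable_set_def)
  qed
  show ?case
  proof (cases "V \<subseteq> S")
    case True
    then have "E = {}" using edge edge_not_sub by blast
    moreover have "V - S = {}" "V = S" using True SV by auto
    ultimately show ?thesis using certificate_stable[of V w a u] fin w a[OF S] by simp
  next
    case False
    then obtain i where i: "i \<in> V" "i \<notin> S" by auto
    define N where "N = {j. {i, j} \<in> E}"
    define V' where "V' = V - {i} - N"
    define E' where "E' = {e \<in> E. i \<notin> e \<and> e \<inter> N = {}}"
    let ?E1 = "{e \<in> E. i \<notin> e}"
    have N: "j \<in> V \<and> j \<noteq> i" if "j \<in> N" for j
      using that edge[of "{i, j}"] by (auto simp: N_def card_2_iff')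
    have le1: "card (V - {i} - S) < card (V - S)"
      using fin i by (intro psubset_card_mono) auto
    \<comment> \<open>\<open>V'\<close> contains no node of \<open>N\<close>, so
      \<open>V' - (S - N)\<close> equals \<open>V' - S\<close>, which misses
      \<open>i\<close>.\<close>
    have le2: "card (V' - (S - N)) < card (V - S)"
      using fin i by (intro psubset_card_mono) (auto simp: V'_def)
    \<comment> \<open>The level is thus at least 2, enough for the quadratic terms.\<close>
    have pos: "1 \<le> card (V - S)" using le1 by simp
    have "Const a - graph_poly (V - {i}) ?E1 w u
        \<in> handelman_cone (V - {i}) (Suc (card (V - {i} - S)))"
    proof (rule less.hyps[OF le1])
      show "simple_graph (V - {i}) ?E1" "stable_set (V - {i}) ?E1 S"
        using G S i by (auto simp: simple_graph_def stable_set_def)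
      show "sum w R \<le> a" if R: "stable_set (V - {i}) ?E1 R" for R
      proof (rule a)
        have "i \<notin> R" using R by (auto simp: stable_set_def)
        then show "stable_set V E R" using R by (auto simp: stable_set_def)
      qed
    qed (use w u in auto)
    \<comment> \<open>By \<open>le1\<close> the smaller certificate fits level |V - S|, leaving room
      for the factor 1 - x_i.\<close>
    then have "Const a - graph_poly (V - {i}) ?E1 w u \<in> handelman_cone (V - {i}) (card (V - S))"
      by (rule cone_mono) (use fin le1 in auto)
    then have 1: "(1 - Var i) * (Const a - graph_poly (V - {i}) ?E1 w u)
        \<in> handelman_cone V (Suc (card (V - S)))"
      by (rule cone_mult_one_minus_Var) (use fin i in auto)
    have "Const (a - w i) - graph_poly V' E' w u
        \<in> handelman_cone V' (Suc (card (V' - (S - N))))"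
    proof (rule less.hyps[OF le2])
      show "simple_graph V' E'"
        using G by (auto simp: simple_graph_def V'_def E'_def)
      show "stable_set V' E' (S - N)"
        using S i by (auto simp: stable_set_def V'_def E'_def)
      \<comment> \<open>The neighbours of \<open>i\<close> are gone, so \<open>insert i R\<close> is
        stable in G and w_i + w(R) \<le> a.\<close>
      show "sum w R \<le> a - w i" if R: "stable_set V' E' R" for R
      proof -
        have RV: "R \<subseteq> V'" using R by (simp add: stable_set_def)
        \<comment> \<open>\<open>stable_set\<close> also tests pairs with equal entries, so
          \<open>{i}\<close> must be excluded as an edge.\<close>
        have "{i} \<notin> E" using edge by fastforce
        have "{j, k} \<notin> E" if "j \<in> R" "k \<in> R" for j k
        proof -
          have "{j, k} \<notin> E'" "{j, k} \<inter> N = {}" "i \<notin> {j, k}"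
            using that R RV by (auto simp: stable_set_def V'_def)
          then show ?thesis by (simp add: E'_def)
        qed
        then have "stable_set V E (insert i R)"
          using RV i \<open>{i} \<notin> E\<close>
          by (auto simp: stable_set_def V'_def N_def insert_commute)
        from a[OF this] show ?thesis
          using RV fin by (subst (asm) sum.insert) (auto simp: V'_def intro: finite_subset)
      qed
    qed (use w u in \<open>auto simp: V'_def E'_def\<close>)
    then have "Const (a - w i) - graph_poly V' E' w u \<in> handelman_cone V' (card (V - S))"
      by (rule cone_mono) (use fin le2 in \<open>auto simp: V'_def\<close>)
    then have 2: "Var i * (Const (a - w i) - graph_poly V' E' w u)
        \<in> handelman_cone V (Suc (card (V - S)))"
      by (rule cone_mult_Var) (use fin i in \<open>auto simp: V'_def\<close>)
    have 3: "(\<Sum>j\<in>N. Const (u {i, j} - w j) * (\<Prod>k\<in>{i, j}. Var k))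
        \<in> handelman_cone V (Suc (card (V - S)))"
    proof (intro cone_sum cone_monomial)
      fix j assume "j \<in> N"
      then show "0 \<le> u {i, j} - w j" using u[of i j] by (simp add: N_def)
      show "{i, j} \<subseteq> V" "card {i, j} \<le> Suc (card (V - S))"
        using N[OF \<open>j \<in> N\<close>] i pos by auto
    qed (rule fin)
    have 4: "(\<Sum>e\<in>?E1 - E'. Const (u e) * (\<Prod>k\<in>insert i e. Var k))
        \<in> handelman_cone V (Suc (card (V - S)))"
    proof (intro cone_sum cone_monomial)
      fix e assume "e \<in> ?E1 - E'"
      then have e: "e \<in> E" "i \<notin> e" by auto
      obtain j k where jk: "e = {j, k}" using edge[OF e(1)] by (auto simp: card_2_iff)
      then show "0 \<le> u e" using u[of j k] w[of j] e edge[OF e(1)] by auto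
      show "insert i e \<subseteq> V" using i edge[OF e(1)] by simp
      \<comment> \<open>\<open>l\<close> and \<open>i\<close> are distinct nodes of
        \<open>V - S\<close>, so the level is at least 3, the degree of this term.\<close>
      obtain l where l: "l \<in> e" "l \<notin> S" using edge_not_sub[OF e(1)] by auto
      then have "card {i, l} \<le> card (V - S)"
        using fin i edge[OF e(1)] by (intro card_mono) auto
      moreover have "i \<noteq> l" using l e by blast
      moreover have "card (insert i e) = 3"
        using edge[OF e(1)] e fin finite_subset[of e V] by simp
      ultimately show "card (insert i e) \<le> Suc (card (V - S))" by simp
    qed (rule fin)
    show ?thesis
      using cone_add[OF cone_add[OF cone_add[OF 1 2] 3] 4] graph_poly_split[OF G i(1), of a w u]
      by (simp only: N_def V'_def E'_def)
  qed
qed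

section \<open>Optimal stable sets and the rank bound\<close>

text \<open>Ensures that maxima over stable sets are attained; \<open>f\<close> will be
  \<open>card\<close> for \<alpha>(G) and \<open>sum w\<close> for \<alpha>(G,w).\<close>

lemma finite_stable_images:
  assumes "simple_graph V E"
  shows "finite {f S | S. stable_set V E S}" "{f S | S. stable_set V E S} \<noteq> {}"
proof -
  have "{f S | S. stable_set V E S} \<subseteq> f ` Pow V" by (auto simp: stable_set_def)
  then show "finite {f S | S. stable_set V E S}"
    by (rule finite_subset) (use assms in \<open>simp add: simple_graph_def\<close>)
  have "stable_set V E {}" by (simp add: stable_set_def)
  then show "{f S | S. stable_set V E S} \<noteq> {}" by blast
qed

theorem theorem6:
  fixes V :: "'a set" and E :: "'a set set"
    and w :: "'a \<Rightarrow> real" and u :: "'a set \<Rightarrow> real"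
  assumes "simple_graph V E"
    and "\<And>i. i \<in> V \<Longrightarrow> 0 \<le> w i"
    and "\<And>i j. {i, j} \<in> E \<Longrightarrow> max (w i) (w j) \<le> u {i, j}"
  shows "handelman_rank V E w u \<le> enat (card V - stability_number V E + 1)"
proof -
  let ?a = "weighted_stability_number V E w" and ?t = "card V - stability_number V E + 1"
  \<comment> \<open>Two optimal sets are used, possibly different: \<open>S\<close> of maximum
    cardinality fixes the level, \<open>R\<close> of maximum weight gives the lower bound.\<close>
  have "stability_number V E \<in> {card S | S. stable_set V E S}"
    unfolding stability_number_def
    using finite_stable_images[OF assms(1), of card] by (rule Max_in)
  then obtain S where S: "stable_set V E S" "card S = stability_number V E" by auto
  have "?a \<in> {(\<Sum>i\<in>S. w i) | S. stable_set V E S}"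
    unfolding weighted_stability_number_def
    using finite_stable_images[OF assms(1), of "sum w"] by (rule Max_in)
  then obtain R where R: "stable_set V E R" "?a = (\<Sum>i\<in>R. w i)" by auto
  \<comment> \<open>The truncated subtraction is exact because
    \<open>S \<subseteq> V\<close>.\<close>
  have t: "?t = Suc (card (V - S))"
    using S assms(1) finite_subset[of S V]
    by (simp add: stable_set_def simple_graph_def card_Diff_subset)
  have "(\<Sum>i\<in>Q. w i) \<le> ?a" if "stable_set V E Q" for Q
    unfolding weighted_stability_number_def
    using finite_stable_images(1)[OF assms(1), of "sum w"] that by (intro Max_ge) auto
  from handelman_certificate[OF assms S(1) this]
  have feasible: "Const ?a - graph_poly V E w u \<in> handelman_cone V ?t" by (simp only: t)
  \<comment> \<open>At the indicator of \<open>R\<close> the polynomial takes the value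
    \<open>l - ?a\<close>, which must be nonnegative.\<close>
  have "?a \<le> l" if "Const l - graph_poly V E w u \<in> handelman_cone V ?t" for l
    using eval_indicator_cone_nonneg[OF that, of R] eval_indicator_graph_poly[OF assms(1) R(1)] R(2) by simp
  then have "handelman_bound V E w u ?t = ereal ?a"
    unfolding handelman_bound_def using feasible
    by (intro antisym Inf_lower Inf_greatest) auto
  then show ?thesis
    unfolding handelman_rank_def by (intro Inf_lower) auto
qed

end
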